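(* Let $K\subset\mathbb{R}^2$ be a convex body that is symmetric about the origin. Then $$d^{(K)}(A+B)^2\leq d^{(K)}(A)^2+d^{(K)}(B)^2$$ holds for all nonempty compact sets $A,B\subset\mathbb{R}^2$ if and only if $K$ is an ellipse.
   Context: A convex body $K\subset\mathbb{R}^2$ is a compact convex set with nonempty interior; it is symmetric about the origin if $K=-K$. For such a symmetric $K$, the norm with closed unit ball $K$ is $\|x\|_K:=\inf\{\lambda>0: x\in\lambda K\}$, $x\in\mathbb{R}^2$. For a nonempty set $S\subset\mathbb{R}^2$, the $K$-Hausdorff distance from convex hull is $$d^{(K)}(S):=\sup_{x\in\mathrm{conv}(S)}\ \inf_{s\in S}\|x-s\|_K,$$ where $\mathrm{conv}(S)$ is the convex hull of $S$. The sum $A+B:=\{a+b: a\in A,\ b\in B\}$ is the Minkowski sum. An ellipse here means a (filled, nondegenerate) ellipse, i.e. the image of the closed Euclidean unit disc $B_2^2$ under an invertible affine map; since $K=-K$, such an ellipse is centered at $0$, i.e. is the image of $B_2^2$ under an invertible linear map. *)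

theory Defs
  imports "HOL-Analysis.Analysis" "HOL-Library.Set_Algebras"
begin

definition convex_body :: "(real^2) set \<Rightarrow> bool" where
  "convex_body K \<longleftrightarrow> compact K \<and> convex K \<and> interior K \<noteq> {}"

definition origin_symmetric :: "(real^2) set \<Rightarrow> bool" where
  "origin_symmetric K \<longleftrightarrow> uminus ` K = K"

definition body_norm :: "(real^2) set \<Rightarrow> real^2 \<Rightarrow> real" where
  "body_norm K x = Inf {l. l > 0 \<and> x \<in> (\<lambda>y. l *\<^sub>R y) ` K}"

text \<open>
  The supremum and infimum are taken in the reals. For an origin-symmetric convex body \<open>K\<close> and a
  nonempty bounded set \<open>S\<close> the two index sets are nonempty, the inner one is bounded below by 0 and
  the outer one is bounded above, so they agree with the extended-real ones; an unbounded \<open>S\<close>,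
  whose distance may be infinite, is not modelled.
\<close>

definition hull_dist :: "(real^2) set \<Rightarrow> (real^2) set \<Rightarrow> real" where
  "hull_dist K S = (SUP x\<in>convex hull S. INF s\<in>S. body_norm K (x - s))"

definition ellipse :: "(real^2) set \<Rightarrow> bool" where
  "ellipse E \<longleftrightarrow> (\<exists>(f :: real^2 \<Rightarrow> real^2) c. linear f \<and> bij f \<and> E = (\<lambda>x. f x + c) ` cball 0 1)"

end

theory Submission
  imports Defs
begin

text \<open>
  \<^bold>\<open>An ellipse gives subadditivity.\<close> A linear change of coordinates turns the norm of a centred ellipse
  into the Euclidean norm of the plane. Let \<open>x\<close> lie in \<open>conv A + conv B\<close>. A Shapley-Folkman count
  (\<open>shapley_folkman_two\<close>) leaves at most four points of \<open>A\<close> and \<open>B\<close> in a convex representation of \<open>x\<close>. If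
  one summand uses a single point, the distance from \<open>x\<close> to \<open>A + B\<close> is at most the hull distance of the
  other set. Otherwise \<open>x\<close> lies in the sum of a segment with ends in \<open>A\<close> and a segment with ends in
  \<open>B\<close>, and among all such representations there is one that minimises the sum of the squared lengths.
  A segment in it that is longer than twice the hull distance of its set would have a point \<open>c\<close> of
  the set close to its midpoint, and the representation could slide across the triangle spanned by
  the segment and \<open>c\<close> until it reaches one of the two shorter sides, against minimality, or an end of
  the other segment, which is the first case again (\<open>long_edge_exchange\<close>). If both segments are short,
  the bound follows by rounding: choosing
  the ends of both segments independently at random with mean \<open>x\<close> gives a variance of at most a quarter
  of the sum of the squared lengths, so some vertex of the parallelogram is that close to \<open>x\<close>
  (\<open>parallelogram_vertex_near\<close>).

  \<^bold>\<open>Subadditivity forces an ellipse.\<close> Write \<open>N\<close> for the norm of \<open>K\<close>. The sets \<open>{0, 2u}\<close> and \<open>{0, 2v}\<close>, with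
  the centre \<open>u + v\<close> of the resulting parallelogram, give
  \<open>min (N (u + v)) (N (u - v))\<^sup>2 \<le> (N u)\<^sup>2 + (N v)\<^sup>2\<close>. Among the quadratic forms \<open>Q \<ge> N\<^sup>2\<close> take
  one of minimal trace and let \<open>C\<close> be the set where \<open>Q = N\<^sup>2\<close>. For \<open>s, t\<close> in \<open>C\<close> of equal norm the
  inequality at \<open>s + t\<close> and \<open>s - t\<close>, against the parallelogram law for \<open>Q\<close>, puts \<open>s + t\<close> in \<open>C\<close>
  (\<open>contact_sum\<close>). As \<open>C\<close> is closed and homogeneous, it is a linear subspace (\<open>closed_cone_sum\<close>).
  If it were contained in a line, \<open>Q\<close> could be decreased in trace (\<open>minimal_trace_contact_off_line\<close>).
  So \<open>C\<close> is the whole plane, \<open>N\<^sup>2 = Q\<close>, and \<open>K\<close> is the ellipse \<open>Q \<le> 1\<close>.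
\<close>

section \<open>The distance of a compact set from its convex hull\<close>

text \<open>The Euclidean case of \<open>hull_dist\<close>, in any dimension.\<close>

definition hull_gap :: "'a::euclidean_space set \<Rightarrow> real" where
  "hull_gap S = (SUP x\<in>convex hull S. infdist x S)"

lemma infdist_le_hull_gap:
  fixes S :: "'a::euclidean_space set"
  assumes "compact S" "x \<in> convex hull S"
  shows "infdist x S \<le> hull_gap S"
proof -
  have "compact (convex hull S)"
    using assms(1) by (rule compact_convex_hull)
  then have "compact ((\<lambda>x. infdist x S) ` (convex hull S))"
    by (intro compact_continuous_image continuous_intros)
  then have "bdd_above ((\<lambda>x. infdist x S) ` (convex hull S))"
    by (rule bounded_imp_bdd_above[OF compact_imp_bounded])
  then show ?thesis
    unfolding hull_gap_def using assms(2) by (rule cSUP_upper2) auto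
qed

lemma hull_gap_nonneg:
  fixes S :: "'a::euclidean_space set"
  assumes "compact S" "S \<noteq> {}"
  shows "0 \<le> hull_gap S"
proof -
  obtain a where "a \<in> S" using assms(2) by blast
  then have "a \<in> convex hull S" by (simp add: hull_inc)
  then show ?thesis
    using infdist_le_hull_gap[OF assms(1)] infdist_nonneg order_trans by blast
qed

section \<open>Representing points of a sum of two convex hulls\<close>

text \<open>
  The set \<open>A\<close> is placed at height 1 and \<open>B\<close> at height 0 in a space of one more dimension. There the point
  of \<open>conv A + conv B\<close>, halved, is a midpoint at height \<open>1/2\<close>, and Caratheodory's theorem needs only
  \<open>DIM('a) + 2\<close> points in all, instead of \<open>DIM('a) + 1\<close> for each summand.
\<close>

lemma shapley_folkman_two:
  fixes A B :: "'a::euclidean_space set"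
  assumes "x \<in> convex hull A + convex hull B"
  obtains S T where "S \<subseteq> A" "T \<subseteq> B" "finite S" "finite T" "S \<noteq> {}" "T \<noteq> {}"
    "card S + card T \<le> DIM('a) + 2" "x \<in> convex hull S + convex hull T"
proof -
  obtain p q where pq: "p \<in> convex hull A" "q \<in> convex hull B" "x = p + q"
    using assms by (auto simp: set_plus_def)
  define L where "L = A \<times> {1::real} \<union> B \<times> {0::real}"
  have sub: "(convex hull A) \<times> {1} \<subseteq> convex hull L" "(convex hull B) \<times> {0} \<subseteq> convex hull L"
    using hull_mono[of "A \<times> {1}" L convex] hull_mono[of "B \<times> {0}" L convex]
    by (auto simp: convex_hull_Times L_def)
  have "(p, 1) \<in> convex hull L" "(q, 0) \<in> convex hull L"
    using sub pq by blast+
  then have "(1/2) *\<^sub>R (p, 1) + (1/2) *\<^sub>R (q, 0) \<in> convex hull L"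
    by (rule convexD[OF convex_convex_hull]) auto
  then have mid: "((1/2) *\<^sub>R x, 1/2) \<in> convex hull L"
    by (simp add: pq scaleR_add_right)
  then obtain W where W: "finite W" "W \<subseteq> L" "card W \<le> DIM('a \<times> real) + 1"
    "((1/2) *\<^sub>R x, 1/2) \<in> convex hull W"
    using caratheodory[of L] by blast
  define S where "S = fst ` (W \<inter> UNIV \<times> {1})"
  define T where "T = fst ` (W \<inter> UNIV \<times> {0})"
  have WST: "W = S \<times> {1} \<union> T \<times> {0}"
    using W(2) by (force simp: S_def T_def L_def)
  have fin: "finite S" "finite T" using W(1) by (auto simp: S_def T_def)
  have "card W = card (S \<times> {1::real}) + card (T \<times> {0::real})"
    unfolding WST by (rule card_Un_disjoint) (use fin in auto)
  then have card: "card S + card T \<le> DIM('a) + 2"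
    using W(3) by (simp add: card_cartesian_product)
  have hS: "convex hull (S \<times> {1::real}) = (convex hull S) \<times> {1}"
    and hT: "convex hull (T \<times> {0::real}) = (convex hull T) \<times> {0}"
    by (simp_all add: convex_hull_Times)
  \<comment> \<open>The last coordinate \<open>1/2\<close> lies strictly between the two layers, so both layers are used.\<close>
  have ne: "S \<noteq> {}" "T \<noteq> {}"
    using W(4) hS hT unfolding WST by auto
  have "convex hull W = convex hull (convex hull (S \<times> {1::real}) \<union> convex hull (T \<times> {0::real}))"
    unfolding WST by (rule hull_Un) (auto intro: convex_Inter)
  also have "\<dots> = {u *\<^sub>R s + v *\<^sub>R t | u v s t. u \<ge> 0 \<and> v \<ge> 0 \<and> u + v = 1
      \<and> s \<in> (convex hull S) \<times> {1::real} \<and> t \<in> (convex hull T) \<times> {0::real}}"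
    unfolding hS hT by (rule convex_hull_union_two) (use ne in \<open>auto intro: convex_Times\<close>)
  finally have hW: "convex hull W = \<dots>" .
  obtain u v s t where *: "u + v = 1" "s \<in> convex hull S" "t \<in> convex hull T"
    "((1/2) *\<^sub>R x, 1/2 :: real) = u *\<^sub>R (s, 1) + v *\<^sub>R (t, 0)"
    using W(4) unfolding hW by blast
  have uv: "u = 1/2" "v = 1/2" using * by simp_all
  have "(1/2) *\<^sub>R x = (1/2) *\<^sub>R (s + t)" using *(4) unfolding uv by (simp add: scaleR_add_right)
  then have "x = s + t" by simp
  then have "x \<in> convex hull S + convex hull T" using * by (auto simp: set_plus_def)
  moreover have "S \<subseteq> A" "T \<subseteq> B" using W(2) unfolding WST L_def by auto
  ultimately show thesis using that fin ne card by blast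
qed

section \<open>Subadditivity for the Euclidean plane\<close>

lemma two_dim_linear_relation:
  fixes u v w :: "'a::euclidean_space"
  assumes "DIM('a) = 2"
  obtains \<alpha> \<beta> \<gamma> :: real where "\<alpha> *\<^sub>R u + \<beta> *\<^sub>R w + \<gamma> *\<^sub>R v = 0" "(\<alpha>, \<beta>, \<gamma>) \<noteq> (0, 0, 0)"
proof -
  define f where "f = (\<lambda>(\<alpha>, \<beta>, \<gamma>). \<alpha> *\<^sub>R u + \<beta> *\<^sub>R w + \<gamma> *\<^sub>R v)"
  have lin: "linear f"
    by (rule linearI) (auto simp: f_def algebra_simps)
  have "\<not> inj f"
  proof
    assume "inj f"
    then have "dim (range f) = dim (UNIV :: (real \<times> real \<times> real) set)"
      by (intro dim_image_eq[OF lin]) auto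
    moreover have "dim (range f) \<le> DIM('a)" by (rule dim_subset_UNIV)
    ultimately show False using assms by simp
  qed
  then obtain c where "f c = 0" "c \<noteq> 0"
    using linear_injective_0[OF lin] by blast
  then show thesis
    using that[of "fst c" "fst (snd c)" "snd (snd c)"]
    by (cases c) (auto simp: f_def zero_prod_def)
qed

text \<open>
  A vertex of the parallelogram is drawn by choosing \<open>i = 1\<close> with probability \<open>s\<close> and, independently,
  \<open>j = 1\<close> with probability \<open>t\<close>. Its mean is the given point, so the mean squared distance is the
  variance \<open>s (1 - s) |u|\<^sup>2 + t (1 - t) |v|\<^sup>2\<close>, and some vertex is no farther than the mean.
\<close>

lemma parallelogram_vertex_near:
  fixes u v :: "'a::real_inner"
  assumes s: "0 \<le> s" "s \<le> 1" and t: "0 \<le> t" "t \<le> 1"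
    and h: "norm u \<le> 2 * h" and k: "norm v \<le> 2 * k"
  obtains i j :: real where "i \<in> {0, 1}" "j \<in> {0, 1}"
    "(norm ((s - i) *\<^sub>R u + (t - j) *\<^sub>R v))\<^sup>2 \<le> h\<^sup>2 + k\<^sup>2"
proof (rule ccontr)
  note near = that
  define F where "F i j = (norm ((s - i) *\<^sub>R u + (t - j) *\<^sub>R v))\<^sup>2" for i j
  assume no: "\<not> thesis"
  have big: "F i j > h\<^sup>2 + k\<^sup>2" if "i \<in> {0, 1}" "j \<in> {0, 1}" for i j
  proof (rule ccontr)
    assume "\<not> h\<^sup>2 + k\<^sup>2 < F i j"
    then have thesis using near[of i j] that by (simp add: F_def)
    then show False using no by blast
  qed
  have F: "F i j = (s - i)\<^sup>2 * (norm u)\<^sup>2 + 2 * ((s - i) * (t - j) * (u \<bullet> v)) + (t - j)\<^sup>2 * (norm v)\<^sup>2" for i j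
    unfolding F_def power2_norm_eq_inner
    by (simp add: inner_add_left inner_add_right inner_commute power2_eq_square algebra_simps)
  \<comment> \<open>The mixed terms cancel because the two choices are independent and centred.\<close>
  have var: "(1-s)*(1-t) * F 0 0 + (1-s)*t * F 0 1 + s*(1-t) * F 1 0 + s*t * F 1 1
      = s*(1-s) * (norm u)\<^sup>2 + t*(1-t) * (norm v)\<^sup>2"
    unfolding F by (simp add: power2_eq_square algebra_simps)
  have quarter: "r * (1 - r) * (norm w)\<^sup>2 \<le> m\<^sup>2" if "norm w \<le> 2 * m" for r m :: real and w :: 'a
  proof -
    have "r * (1 - r) \<le> 1/4" using zero_le_power2[of "r - 1/2"] by (simp add: power2_eq_square algebra_simps)
    then have "r * (1 - r) * (norm w)\<^sup>2 \<le> 1/4 * (norm w)\<^sup>2" by (rule mult_right_mono) simp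
    also have "\<dots> \<le> 1/4 * (2 * m)\<^sup>2" using that by (intro mult_left_mono power_mono) auto
    finally show ?thesis by (simp add: power2_eq_square)
  qed
  have "(1-s)*(1-t) * (h\<^sup>2 + k\<^sup>2) + (1-s)*t * (h\<^sup>2 + k\<^sup>2) + s*(1-t) * (h\<^sup>2 + k\<^sup>2) + s*t * (h\<^sup>2 + k\<^sup>2)
     < (1-s)*(1-t) * F 0 0 + (1-s)*t * F 0 1 + s*(1-t) * F 1 0 + s*t * F 1 1"
  proof -
    have le: "c * (h\<^sup>2 + k\<^sup>2) \<le> c * F i j" if "0 \<le> c" "i \<in> {0, 1}" "j \<in> {0, 1}" for c i j
      using big[OF that(2,3)] that(1) by (intro mult_left_mono) auto
    have lt: "c * (h\<^sup>2 + k\<^sup>2) < c * F i j" if "0 < c" "i \<in> {0, 1}" "j \<in> {0, 1}" for c i j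
      using big[OF that(2,3)] that(1) by (intro mult_strict_left_mono) auto
    have nn: "0 \<le> (1-s)*(1-t)" "0 \<le> (1-s)*t" "0 \<le> s*(1-t)" "0 \<le> s*t" using s t by auto
    have "(1-s)*(1-t) + (1-s)*t + s*(1-t) + s*t = 1" by (simp add: algebra_simps)
    then have "0 < (1-s)*(1-t) \<or> 0 < (1-s)*t \<or> 0 < s*(1-t) \<or> 0 < s*t"
      using nn by linarith
    then show ?thesis
      using le[OF nn(1), of 0 0] le[OF nn(2), of 0 1] le[OF nn(3), of 1 0] le[OF nn(4), of 1 1]
        lt[of "(1-s)*(1-t)" 0 0] lt[of "(1-s)*t" 0 1] lt[of "s*(1-t)" 1 0] lt[of "s*t" 1 1]
      by auto
  qed
  also have "\<dots> \<le> h\<^sup>2 + k\<^sup>2"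
    unfolding var using quarter[OF h] quarter[OF k] by (rule add_mono)
  finally show False by (simp add: algebra_simps)
qed

text \<open>
  In the plane \<open>u\<close>, \<open>w\<close>, \<open>v\<close> satisfy a linear relation. Adding multiples of it to
  \<open>s u + 0 w + t v\<close> keeps the vector and moves a point from the side \<open>u\<close> into the triangle \<open>0, u, w\<close>, in
  step with a point of the segment \<open>v\<close>. The motion is stopped at the side \<open>w\<close>, at the side from \<open>u\<close> to \<open>w\<close>,
  or at an end of the segment \<open>v\<close>, and never by the side it started from.
\<close>

lemma triangle_edge_exit:
  fixes u w v :: "'a::euclidean_space"
  assumes "DIM('a) = 2"
    and s: "0 \<le> s" "s \<le> 1" and t: "0 \<le> t" "t \<le> 1"
  obtains (first) r t' where "0 \<le> r" "r \<le> 1" "0 \<le> t'" "t' \<le> 1"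
      "s *\<^sub>R u + t *\<^sub>R v = r *\<^sub>R w + t' *\<^sub>R v"
  | (second) r t' where "0 \<le> r" "r \<le> 1" "0 \<le> t'" "t' \<le> 1"
      "s *\<^sub>R u + t *\<^sub>R v = (1 - r) *\<^sub>R u + r *\<^sub>R w + t' *\<^sub>R v"
  | (vertex) l m t' where "0 \<le> l" "0 \<le> m" "l + m \<le> 1" "t' \<in> {0, 1}"
      "s *\<^sub>R u + t *\<^sub>R v = l *\<^sub>R u + m *\<^sub>R w + t' *\<^sub>R v"
proof -
  \<comment> \<open>Choosing the sign of the relation with \<open>\<beta> \<ge> 0\<close> makes the motion point into the triangle or along
    the starting side, so that the starting side imposes no constraint.\<close>
  obtain \<alpha> \<beta> \<gamma> where dep: "\<alpha> *\<^sub>R u + \<beta> *\<^sub>R w + \<gamma> *\<^sub>R v = 0" and nz: "(\<alpha>, \<beta>, \<gamma>) \<noteq> (0, 0, 0)"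
    and "0 \<le> \<beta>"
  proof -
    obtain \<alpha> \<beta> \<gamma> where *: "\<alpha> *\<^sub>R u + \<beta> *\<^sub>R w + \<gamma> *\<^sub>R v = 0" "(\<alpha>, \<beta>, \<gamma>) \<noteq> (0, 0, 0)"
      using two_dim_linear_relation[OF assms(1)] by blast
    have "(- \<alpha>) *\<^sub>R u + (- \<beta>) *\<^sub>R w + (- \<gamma>) *\<^sub>R v = - (\<alpha> *\<^sub>R u + \<beta> *\<^sub>R w + \<gamma> *\<^sub>R v)"
      by simp
    then have "(- \<alpha>) *\<^sub>R u + (- \<beta>) *\<^sub>R w + (- \<gamma>) *\<^sub>R v = 0" using * by simp
    then show thesis using that[of \<alpha> \<beta> \<gamma>] that[of "-\<alpha>" "-\<beta>" "-\<gamma>"] *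
      by (cases "0 \<le> \<beta>") auto
  qed
  define good where "good \<tau> \<longleftrightarrow> 0 \<le> \<tau> \<and> 0 \<le> s + \<tau> * \<alpha> \<and> s + \<tau> * \<alpha> + \<tau> * \<beta> \<le> 1
      \<and> 0 \<le> t + \<tau> * \<gamma> \<and> t + \<tau> * \<gamma> \<le> 1" for \<tau>
  \<comment> \<open>Slide along the relation as far as all coefficients stay admissible.\<close>
  obtain \<tau> where \<tau>: "good \<tau>" and max: "\<And>\<sigma>. good \<sigma> \<Longrightarrow> \<sigma> \<le> \<tau>"
  proof -
    have "closed {\<tau>. good \<tau>}"
      unfolding good_def by (intro closed_Collect_conj closed_Collect_le continuous_intros)
    moreover have "bounded {\<tau>. good \<tau>}"
    proof -
      consider "0 < \<alpha> + \<beta>" | "\<alpha> < 0" | "0 < \<gamma>" | "\<gamma> < 0" using nz \<open>0 \<le> \<beta>\<close> by force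
      then have "\<exists>M. \<forall>\<tau>. good \<tau> \<longrightarrow> \<tau> \<le> M"
      proof cases
        case 1
        then have "\<forall>\<tau>. good \<tau> \<longrightarrow> \<tau> \<le> (1 - s) / (\<alpha> + \<beta>)" by (auto simp: good_def field_simps)
        then show ?thesis by blast
      next
        case 2
        then have "\<forall>\<tau>. good \<tau> \<longrightarrow> \<tau> \<le> s / (- \<alpha>)" by (auto simp: good_def field_simps)
        then show ?thesis by blast
      next
        case 3
        then have "\<forall>\<tau>. good \<tau> \<longrightarrow> \<tau> \<le> (1 - t) / \<gamma>" by (auto simp: good_def field_simps)
        then show ?thesis by blast
      next
        case 4
        then have "\<forall>\<tau>. good \<tau> \<longrightarrow> \<tau> \<le> t / (- \<gamma>)" by (auto simp: good_def field_simps)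
        then show ?thesis by blast
      qed
      then obtain M where "\<forall>\<tau>. good \<tau> \<longrightarrow> \<tau> \<le> M" ..
      then have "{\<tau>. good \<tau>} \<subseteq> {0..M}" by (auto simp: good_def)
      then show ?thesis using bounded_closed_interval bounded_subset by blast
    qed
    ultimately have "compact {\<tau>. good \<tau>}" by (simp add: compact_eq_bounded_closed)
    moreover have "good 0" using s t by (simp add: good_def)
    ultimately show thesis using that compact_attains_sup[of "{\<tau>. good \<tau>}"] by blast
  qed
  define l m t' where "l = s + \<tau> * \<alpha>" and "m = \<tau> * \<beta>" and "t' = t + \<tau> * \<gamma>"
  have rng: "0 \<le> l" "0 \<le> m" "l + m \<le> 1" "0 \<le> t'" "t' \<le> 1"
    using \<tau> \<open>0 \<le> \<beta>\<close> by (auto simp: good_def l_def m_def t'_def)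
  have "l *\<^sub>R u + m *\<^sub>R w + t' *\<^sub>R v
      = s *\<^sub>R u + t *\<^sub>R v + \<tau> *\<^sub>R (\<alpha> *\<^sub>R u + \<beta> *\<^sub>R w + \<gamma> *\<^sub>R v)"
    by (simp add: l_def m_def t'_def algebra_simps)
  then have eq: "s *\<^sub>R u + t *\<^sub>R v = l *\<^sub>R u + m *\<^sub>R w + t' *\<^sub>R v" by (simp add: dep)
  \<comment> \<open>At a maximal slide some constraint is an equality, otherwise it could be continued.\<close>
  have tight: "l = 0 \<or> l + m = 1 \<or> t' = 0 \<or> t' = 1"
  proof (rule ccontr)
    assume "\<not> ?thesis"
    then have strict: "0 < l" "l + m < 1" "0 < t'" "t' < 1" using rng by auto
    have "((\<lambda>\<sigma>. s + \<sigma> * \<alpha>) \<longlongrightarrow> l) (at_right \<tau>)" "((\<lambda>\<sigma>. s + \<sigma> * \<alpha> + \<sigma> * \<beta>) \<longlongrightarrow> l + m) (at_right \<tau>)"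
      "((\<lambda>\<sigma>. t + \<sigma> * \<gamma>) \<longlongrightarrow> t') (at_right \<tau>)"
      unfolding l_def m_def t'_def by (intro tendsto_intros)+
    then have "eventually (\<lambda>\<sigma>. 0 < s + \<sigma> * \<alpha> \<and> s + \<sigma> * \<alpha> + \<sigma> * \<beta> < 1 \<and> 0 < t + \<sigma> * \<gamma> \<and> t + \<sigma> * \<gamma> < 1) (at_right \<tau>)"
      using strict by (auto intro!: eventually_conj dest: order_tendstoD)
    then have "eventually (\<lambda>\<sigma>. good \<sigma> \<and> \<sigma> > \<tau>) (at_right \<tau>)"
      using eventually_at_right_less[of \<tau>] by eventually_elim (use \<tau> in \<open>auto simp: good_def\<close>)
    then obtain \<sigma> where "good \<sigma>" "\<sigma> > \<tau>"
      using eventually_happens trivial_limit_at_right_real by blast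
    then show False using max[of \<sigma>] by simp
  qed
  then consider "l = 0" | "l + m = 1" | "t' \<in> {0, 1}" by auto
  then show thesis
  proof cases
    case 1 then show thesis using first[of m t'] rng eq by auto
  next
    case 2 then have "l = 1 - m" by simp
    then show thesis using second[of m t'] rng eq by auto
  next
    case 3 then show thesis using vertex rng eq by blast
  qed
qed

lemma infdist_sum_le_hull_gap:
  fixes A B :: "'a::euclidean_space set"
  assumes "compact B" "a \<in> A" "q \<in> convex hull B"
  shows "infdist (a + q) (A + B) \<le> hull_gap B"
proof -
  have "B \<noteq> {}" using assms(3) by auto
  then obtain b where b: "b \<in> B" "infdist q B = dist q b"
    using infdist_attains_inf[OF compact_imp_closed[OF assms(1)]] by blast
  have "a + b \<in> A + B" using assms(2) b by (auto simp: set_plus_def)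
  then have "infdist (a + q) (A + B) \<le> dist (a + q) (a + b)" by (rule infdist_le)
  also have "\<dots> = infdist q B" using b by simp
  also have "\<dots> \<le> hull_gap B" using assms infdist_le_hull_gap by blast
  finally show ?thesis .
qed

text \<open>
  A long edge has a point \<open>c\<close> of \<open>A\<close> within less than half its length of the midpoint, so both other
  sides of the triangle \<open>a1, a2, c\<close> are shorter. Sliding the representation across this triangle
  either reaches one of these sides or makes the second summand a point of \<open>B\<close>.
\<close>

lemma long_edge_exchange:
  fixes A B :: "'a::euclidean_space set"
  assumes "DIM('a) = 2" "compact A"
    and a: "a1 \<in> A" "a2 \<in> A" and b: "b1 \<in> B" "b2 \<in> B"
    and x: "x \<in> closed_segment a1 a2 + closed_segment b1 b2"
    and long: "2 * hull_gap A < dist a1 a2"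
  obtains (near) "infdist x (A + B) \<le> hull_gap A"
  | (shorter) c1 c2 where "c1 \<in> A" "c2 \<in> A" "dist c1 c2 < dist a1 a2"
      "x \<in> closed_segment c1 c2 + closed_segment b1 b2"
proof -
  define m where "m = midpoint a1 a2"
  have "m \<in> closed_segment a1 a2" by (simp add: m_def midpoint_in_closed_segment)
  moreover have "closed_segment a1 a2 \<subseteq> convex hull A"
    using a by (simp add: closed_segment_subset_convex_hull hull_inc)
  ultimately have "infdist m A \<le> hull_gap A"
    using infdist_le_hull_gap[OF assms(2)] by blast
  moreover obtain c where c: "c \<in> A" "infdist m A = dist m c"
    using infdist_attains_inf[OF compact_imp_closed[OF assms(2)]] a by blast
  ultimately have mc: "dist m c < dist a1 a2 / 2" using long by simp
  have short: "dist a1 c < dist a1 a2" "dist a2 c < dist a1 a2"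
    using mc dist_triangle[of a1 c m] dist_triangle[of a2 c m]
    by (auto simp: m_def dist_midpoint)
  obtain s t where st: "0 \<le> s" "s \<le> 1" "0 \<le> t" "t \<le> 1"
    "x = (1 - s) *\<^sub>R a1 + s *\<^sub>R a2 + ((1 - t) *\<^sub>R b1 + t *\<^sub>R b2)"
    using x by (auto simp: set_plus_def in_segment)
  then have x': "x = a1 + b1 + (s *\<^sub>R (a2 - a1) + t *\<^sub>R (b2 - b1))"
    by (simp add: algebra_simps)
  have onb: "b1 + t' *\<^sub>R (b2 - b1) \<in> closed_segment b1 b2" if "0 \<le> t'" "t' \<le> 1" for t'
    unfolding in_segment by (rule exI[of _ t']) (use that in \<open>simp add: algebra_simps\<close>)
  from assms(1) st(1-4) show thesis
  proof (cases rule: triangle_edge_exit[where u = "a2 - a1" and w = "c - a1" and v = "b2 - b1"])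
    case (first r t')
    have "a1 + r *\<^sub>R (c - a1) \<in> closed_segment a1 c"
      unfolding in_segment by (rule exI[of _ r]) (use first in \<open>simp add: algebra_simps\<close>)
    moreover have "x = (a1 + r *\<^sub>R (c - a1)) + (b1 + t' *\<^sub>R (b2 - b1))"
      unfolding x' first(5) by (simp add: algebra_simps)
    ultimately have "x \<in> closed_segment a1 c + closed_segment b1 b2"
      using onb first set_plus_intro by blast
    then show thesis using shorter a c short by blast
  next
    case (second r t')
    have "a1 + (1 - r) *\<^sub>R (a2 - a1) + r *\<^sub>R (c - a1) \<in> closed_segment a2 c"
      unfolding in_segment by (rule exI[of _ r]) (use second in \<open>simp add: algebra_simps\<close>)
    moreover have "x = (a1 + (1 - r) *\<^sub>R (a2 - a1) + r *\<^sub>R (c - a1)) + (b1 + t' *\<^sub>R (b2 - b1))"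
      unfolding x' second(5) by (simp add: algebra_simps)
    ultimately have "x \<in> closed_segment a2 c + closed_segment b1 b2"
      using onb second set_plus_intro by blast
    then show thesis using shorter a c short by blast
  next
    case (vertex l m t')
    define p where "p = (1 - l - m) *\<^sub>R a1 + l *\<^sub>R a2 + m *\<^sub>R c"
    have "p \<in> convex hull {a1, a2, c}"
      unfolding convex_hull_3 p_def
      by (rule CollectI, rule exI[of _ "1 - l - m"], rule exI[of _ l], rule exI[of _ m]) (use vertex in simp)
    then have p: "p \<in> convex hull A" using a c hull_mono[of "{a1, a2, c}" A] by auto
    have "b1 + t' *\<^sub>R (b2 - b1) \<in> B" using vertex b by auto
    then have "infdist (b1 + t' *\<^sub>R (b2 - b1) + p) (B + A) \<le> hull_gap A"
      using infdist_sum_le_hull_gap[OF assms(2) _ p] by blast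
    moreover have "x = b1 + t' *\<^sub>R (b2 - b1) + p"
      unfolding x' vertex(5) p_def by (simp add: algebra_simps)
    ultimately show thesis using near by (simp add: add.commute)
  qed
qed

text \<open>
  The representation with the least sum of squared edge lengths exists by compactness. Unless
  \<open>x\<close> is already as close to \<open>A + B\<close> as one of the two hull distances, no exchange is
  possible, so both edges are short enough for rounding.
\<close>

lemma infdist_sum_bound_edges:
  fixes A B :: "'a::euclidean_space set"
  assumes "DIM('a) = 2" "compact A" "compact B"
    and ab: "a1 \<in> A" "a2 \<in> A" "b1 \<in> B" "b2 \<in> B"
    and x: "x \<in> closed_segment a1 a2 + closed_segment b1 b2"
  shows "(infdist x (A + B))\<^sup>2 \<le> (hull_gap A)\<^sup>2 + (hull_gap B)\<^sup>2"
proof -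
  define Z where "Z = ((A \<times> A) \<times> (B \<times> B) \<times> ({0..1::real} \<times> {0..1::real})) \<inter>
    {((a1, a2), (b1, b2), (s, t)).
      x = (1 - s) *\<^sub>R a1 + s *\<^sub>R a2 + ((1 - t) *\<^sub>R b1 + t *\<^sub>R b2)}"
  define w where "w = (\<lambda>((a1::'a, a2::'a), (b1::'a, b2::'a), (s::real, t::real)). (dist a1 a2)\<^sup>2 + (dist b1 b2)\<^sup>2 :: real)"
  have inZ: "\<exists>s t. ((p1, p2), (q1, q2), (s, t)) \<in> Z"
    if "p1 \<in> A" "p2 \<in> A" "q1 \<in> B" "q2 \<in> B"
      and seg: "x \<in> closed_segment p1 p2 + closed_segment q1 q2" for p1 p2 q1 q2
  proof -
    obtain s t where "0 \<le> s" "s \<le> 1" "0 \<le> t" "t \<le> 1"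
      "x = (1 - s) *\<^sub>R p1 + s *\<^sub>R p2 + ((1 - t) *\<^sub>R q1 + t *\<^sub>R q2)"
      using seg by (auto simp: set_plus_def in_segment)
    then show ?thesis
      unfolding Z_def using that(1-4) by (intro exI[of _ s] exI[of _ t]) simp
  qed
  have "compact Z"
    unfolding Z_def split_beta
    by (intro compact_Int_closed compact_Times assms compact_Icc closed_Collect_eq continuous_intros)
  moreover have "Z \<noteq> {}"
  proof -
    obtain s t where "((a1, a2), (b1, b2), (s, t)) \<in> Z"
      using inZ[OF ab x] by blast
    then show ?thesis by blast
  qed
  moreover have "continuous_on Z w"
    unfolding w_def split_beta by (intro continuous_intros)
  ultimately obtain z where z: "z \<in> Z" "\<And>y. y \<in> Z \<Longrightarrow> w z \<le> w y"
    using continuous_attains_inf by metis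
  obtain c1 c2 d1 d2 s t where zeq: "z = ((c1, c2), (d1, d2), (s, t))"
    by (metis surj_pair)
  have mem: "c1 \<in> A" "c2 \<in> A" "d1 \<in> B" "d2 \<in> B" and st: "0 \<le> s" "s \<le> 1" "0 \<le> t" "t \<le> 1"
    and xeq: "x = (1 - s) *\<^sub>R c1 + s *\<^sub>R c2 + ((1 - t) *\<^sub>R d1 + t *\<^sub>R d2)"
    using z(1) by (auto simp: Z_def zeq)
  have xseg: "x \<in> closed_segment c1 c2 + closed_segment d1 d2"
    unfolding xeq by (intro set_plus_intro) (use st in \<open>auto simp: in_segment\<close>)
  have minimal: "(dist c1 c2)\<^sup>2 + (dist d1 d2)\<^sup>2 \<le> (dist p1 p2)\<^sup>2 + (dist q1 q2)\<^sup>2"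
    if "p1 \<in> A" "p2 \<in> A" "q1 \<in> B" "q2 \<in> B" "x \<in> closed_segment p1 p2 + closed_segment q1 q2" for p1 p2 q1 q2
  proof -
    note prem = that
    obtain s' t' where "((p1, p2), (q1, q2), (s', t')) \<in> Z"
      using inZ[OF prem] by blast
    from z(2)[OF this] show ?thesis by (simp add: w_def zeq)
  qed
  show ?thesis
  proof (cases "infdist x (A + B) \<le> max (hull_gap A) (hull_gap B)")
    case True
    moreover have "0 \<le> infdist x (A + B)" by (rule infdist_nonneg)
    ultimately have "(infdist x (A + B))\<^sup>2 \<le> (max (hull_gap A) (hull_gap B))\<^sup>2"
      by (intro power_mono)
    also have "\<dots> \<le> (hull_gap A)\<^sup>2 + (hull_gap B)\<^sup>2" by (auto simp: max_def)
    finally show ?thesis .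
  next
    case False
    have A: "dist c1 c2 \<le> 2 * hull_gap A"
    proof (rule ccontr)
      assume "\<not> ?thesis"
      then have "2 * hull_gap A < dist c1 c2" by simp
      from assms(1,2) mem xseg this show False
      proof (cases rule: long_edge_exchange)
        case near then show False using False by simp
      next
        case (shorter e1 e2)
        from this(3) have "(dist e1 e2)\<^sup>2 < (dist c1 c2)\<^sup>2" by (intro power_strict_mono) auto
        then show False using minimal[of e1 e2 d1 d2] shorter mem by simp
      qed
    qed
    have B: "dist d1 d2 \<le> 2 * hull_gap B"
    proof (rule ccontr)
      assume "\<not> ?thesis"
      then have long: "2 * hull_gap B < dist d1 d2" by simp
      have "x \<in> closed_segment d1 d2 + closed_segment c1 c2"
        using xseg by (simp add: add.commute)
      from assms(1,3) mem(3,4,1,2) this long show False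
      proof (cases rule: long_edge_exchange[where A = B and B = A])
        case near then show False using False by (simp add: add.commute)
      next
        case (shorter e1 e2)
        from this(3) have "(dist e1 e2)\<^sup>2 < (dist d1 d2)\<^sup>2" by (intro power_strict_mono) auto
        then show False using minimal[of c1 c2 e1 e2] shorter mem by (simp add: add.commute)
      qed
    qed
    obtain i j where ij: "i \<in> {0, 1}" "j \<in> {0, 1}"
      "(norm ((s - i) *\<^sub>R (c2 - c1) + (t - j) *\<^sub>R (d2 - d1)))\<^sup>2 \<le> (hull_gap A)\<^sup>2 + (hull_gap B)\<^sup>2"
      using parallelogram_vertex_near[of s t "c2 - c1" "hull_gap A" "d2 - d1" "hull_gap B"] st A B
      by (auto simp: dist_norm norm_minus_commute)
    define y where "y = (c1 + i *\<^sub>R (c2 - c1)) + (d1 + j *\<^sub>R (d2 - d1))"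
    have "y \<in> A + B" unfolding y_def using ij mem by (intro set_plus_intro) auto
    then have "infdist x (A + B) \<le> dist x y" by (rule infdist_le)
    also have "x - y = (s - i) *\<^sub>R (c2 - c1) + (t - j) *\<^sub>R (d2 - d1)"
      unfolding xeq y_def by (simp add: algebra_simps)
    then have "dist x y = norm ((s - i) *\<^sub>R (c2 - c1) + (t - j) *\<^sub>R (d2 - d1))"
      by (simp add: dist_norm)
    finally have "(infdist x (A + B))\<^sup>2 \<le> (norm ((s - i) *\<^sub>R (c2 - c1) + (t - j) *\<^sub>R (d2 - d1)))\<^sup>2"
      by (intro power_mono infdist_nonneg)
    then show ?thesis using ij(3) by linarith
  qed
qed

lemma compact_set_plus:
  fixes A B :: "'a::real_normed_vector set"
  assumes "compact A" "compact B"
  shows "compact (A + B)"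
proof -
  have "A + B = {x + y | x y. x \<in> A \<and> y \<in> B}" by (auto simp: set_plus_def)
  then show ?thesis using compact_sums[OF assms] by simp
qed

theorem hull_gap_sum_planar:
  fixes A B :: "'a::euclidean_space set"
  assumes dim: "DIM('a) = 2" and A: "compact A" "A \<noteq> {}" and B: "compact B" "B \<noteq> {}"
  shows "(hull_gap (A + B))\<^sup>2 \<le> (hull_gap A)\<^sup>2 + (hull_gap B)\<^sup>2"
proof -
  have pt: "(infdist x (A + B))\<^sup>2 \<le> (hull_gap A)\<^sup>2 + (hull_gap B)\<^sup>2" if "x \<in> convex hull (A + B)" for x
  proof -
    have "x \<in> convex hull A + convex hull B" using that by (simp add: convex_hull_set_plus)
    then obtain S T where ST: "S \<subseteq> A" "T \<subseteq> B" "finite S" "finite T" "S \<noteq> {}" "T \<noteq> {}"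
      "card S + card T \<le> 4" "x \<in> convex hull S + convex hull T"
      by (rule shapley_folkman_two) (use dim in auto)
    obtain p q where pq: "p \<in> convex hull S" "q \<in> convex hull T" "x = p + q"
      using ST(8) by (auto simp: set_plus_def)
    have hulls: "p \<in> convex hull A" "q \<in> convex hull B"
      using pq ST(1,2) hull_mono by blast+
    have "card S > 0" "card T > 0" using ST by (auto simp: card_gt_0_iff)
    then consider "card S = 1" | "card T = 1" | "card S = 2" "card T = 2" using ST(7) by linarith
    then show ?thesis
    proof cases
      case 1
      then have "p \<in> A" using pq(1) ST(1) by (auto simp: card_1_singleton_iff)
      then have "infdist x (A + B) \<le> hull_gap B"
        using infdist_sum_le_hull_gap[OF B(1) _ hulls(2)] pq(3) by blast
      then have "(infdist x (A + B))\<^sup>2 \<le> (hull_gap B)\<^sup>2" by (intro power_mono infdist_nonneg)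
      then show ?thesis using zero_le_power2[of "hull_gap A"] by linarith
    next
      case 2
      then have "q \<in> B" using pq(2) ST(2) by (auto simp: card_1_singleton_iff)
      then have "infdist x (A + B) \<le> hull_gap A"
        using infdist_sum_le_hull_gap[OF A(1) _ hulls(1)] pq(3) by (metis add.commute)
      then have "(infdist x (A + B))\<^sup>2 \<le> (hull_gap A)\<^sup>2" by (intro power_mono infdist_nonneg)
      then show ?thesis using zero_le_power2[of "hull_gap B"] by linarith
    next
      case 3
      then obtain a1 a2 b1 b2 where "S = {a1, a2}" "T = {b1, b2}" by (meson card_2_iff)
      then show ?thesis
        using infdist_sum_bound_edges[OF dim A(1) B(1), of a1 a2 b1 b2 x] ST
        by (simp add: segment_convex_hull)
    qed
  qed
  have "convex hull (A + B) \<noteq> {}" using A B by (auto simp: set_plus_def)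
  then have "hull_gap (A + B) \<le> sqrt ((hull_gap A)\<^sup>2 + (hull_gap B)\<^sup>2)"
    unfolding hull_gap_def[of "A + B"] by (rule cSUP_least) (use pt in \<open>simp add: real_le_rsqrt\<close>)
  moreover have "0 \<le> hull_gap (A + B)"
    using A B by (intro hull_gap_nonneg compact_set_plus) (auto simp: set_plus_def)
  ultimately have "(hull_gap (A + B))\<^sup>2 \<le> (sqrt ((hull_gap A)\<^sup>2 + (hull_gap B)\<^sup>2))\<^sup>2"
    by (intro power_mono)
  then show ?thesis by simp
qed


section \<open>Reduction of ellipses to the Euclidean norm\<close>

lemma body_norm_linear_ball:
  fixes f :: "real^2 \<Rightarrow> real^2"
  assumes "linear f" "bij f"
  shows "body_norm (f ` cball 0 1) x = norm (inv f x)"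
proof -
  have "x \<in> (\<lambda>y. l *\<^sub>R y) ` (f ` cball 0 1) \<longleftrightarrow> norm (inv f x) \<le> l" if "l > 0" for l
  proof
    assume "x \<in> (\<lambda>y. l *\<^sub>R y) ` (f ` cball 0 1)"
    then obtain y where y: "norm y \<le> 1" "x = l *\<^sub>R f y" by auto
    then have "x = f (l *\<^sub>R y)" using assms(1) by (simp add: linear_scale)
    then have "inv f x = l *\<^sub>R y" using assms(2) by (simp add: bij_is_inj)
    then show "norm (inv f x) \<le> l" using y(1) that by (simp add: mult_left_le)
  next
    assume le: "norm (inv f x) \<le> l"
    have "x = l *\<^sub>R f ((1 / l) *\<^sub>R inv f x)"
      using that assms by (simp add: linear_scale bij_is_surj surj_f_inv_f)
    moreover have "(1 / l) *\<^sub>R inv f x \<in> cball 0 1" using le that by simp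
    ultimately show "x \<in> (\<lambda>y. l *\<^sub>R y) ` (f ` cball 0 1)" by blast
  qed
  then have eq: "{l. l > 0 \<and> x \<in> (\<lambda>y. l *\<^sub>R y) ` (f ` cball 0 1)} = {l. l > 0 \<and> norm (inv f x) \<le> l}"
    by auto
  show ?thesis
  proof (cases "inv f x = 0")
    case True
    then have "{l. l > 0 \<and> norm (inv f x) \<le> l} = {0<..}" by auto
    then show ?thesis unfolding body_norm_def eq using True by simp
  next
    case False
    then have "0 < norm (inv f x)" by simp
    then have "{l. l > 0 \<and> norm (inv f x) \<le> l} = {norm (inv f x)..}"
      by (auto simp del: zero_less_norm_iff intro: order.strict_trans2)
    then show ?thesis unfolding body_norm_def eq by simp
  qed
qed

text \<open>
  If the centre were \<open>f e\<close> with \<open>e \<noteq> 0\<close>, then \<open>f (e + e / |e|)\<close> would be a boundary point, and its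
  negative would lie outside: in the coordinates of \<open>f\<close> it has distance \<open>1 + 2 |e|\<close> from the centre.
\<close>

lemma ellipse_symmetric_centered:
  assumes "ellipse K" "origin_symmetric K"
  obtains f :: "real^2 \<Rightarrow> real^2" where "linear f" "bij f" "K = f ` cball 0 1"
proof -
  obtain f :: "real^2 \<Rightarrow> real^2" and c where f: "linear f" "bij f" "K = (\<lambda>x. f x + c) ` cball 0 1"
    using assms(1) by (auto simp: ellipse_def)
  obtain e where e: "c = f e" using f(2) by (metis bij_pointE)
  have "e = 0"
  proof (rule ccontr)
    assume "e \<noteq> 0"
    define d where "d = (1 / norm e) *\<^sub>R e"
    have d: "norm d = 1" "e = norm e *\<^sub>R d" using \<open>e \<noteq> 0\<close> by (auto simp: d_def)
    have "f d + c \<in> K" unfolding f(3) using d by (intro imageI) simp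
    then have "- (f d + c) \<in> K" using assms(2) by (metis imageI origin_symmetric_def)
    then obtain y where y: "y \<in> cball 0 1" "- (f d + c) = f y + c" unfolding f(3) by blast
    have "f y = - (f d + c) - c" unfolding y(2) by simp
    also have "\<dots> = - ((f d + f e) + f e)" unfolding e by (simp only: minus_add_distrib diff_conv_add_uminus)
    also have "\<dots> = f (- (d + e + e))"
      using f(1) by (simp only: linear_add linear_neg)
    finally have "y = - (d + e + e)" using f(2) by (simp only: bij_is_inj inj_eq)
    moreover have "d + e + e = (1 + norm e + norm e) *\<^sub>R d"
      by (simp only: scaleR_add_left scaleR_one flip: d(2))
    ultimately have "norm y = 1 + norm e + norm e" using d(1) by simp
    then show False using y(1) \<open>e \<noteq> 0\<close> by simp
  qed
  then have "c = 0" using e f(1) by (simp add: linear_0)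
  then show thesis using that f by simp
qed

lemma hull_dist_linear_ball:
  fixes f :: "real^2 \<Rightarrow> real^2"
  assumes f: "linear f" "bij f" and S: "S \<noteq> {}"
  shows "hull_dist (f ` cball 0 1) S = hull_gap (inv f ` S)"
proof -
  have lin: "linear (inv f)"
    using f by (intro inj_linear_imp_inv_linear bij_is_inj)
  have "infdist (inv f x) (inv f ` S) = (INF s\<in>S. body_norm (f ` cball 0 1) (x - s))" for x
    using S by (simp add: infdist_notempty image_image body_norm_linear_ball[OF f] dist_norm linear_diff[OF lin])
  then show ?thesis
    unfolding hull_dist_def hull_gap_def convex_hull_linear_image[OF lin, symmetric]
    by (simp add: image_image)
qed

lemma image_set_plus_linear:
  assumes "linear g"
  shows "g ` (A + B) = g ` A + g ` B"
  by (force simp: set_plus_def image_iff linear_add[OF assms])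

theorem ellipse_hull_dist_subadditive:
  assumes "ellipse K" "origin_symmetric K" and A: "compact A" "A \<noteq> {}" and B: "compact B" "B \<noteq> {}"
  shows "(hull_dist K (A + B))\<^sup>2 \<le> (hull_dist K A)\<^sup>2 + (hull_dist K B)\<^sup>2"
proof -
  obtain f :: "real^2 \<Rightarrow> real^2" where f: "linear f" "bij f" and K: "K = f ` cball 0 1"
    using ellipse_symmetric_centered[OF assms(1,2)] .
  have lin: "linear (inv f)"
    using f by (intro inj_linear_imp_inv_linear bij_is_inj)
  have cont: "continuous_on S (inv f)" for S
    by (rule linear_continuous_on) (use lin in \<open>simp add: linear_conv_bounded_linear\<close>)
  have "A + B \<noteq> {}" using A B by (auto simp: set_plus_def)
  then show ?thesis
    unfolding K
    using hull_gap_sum_planar[of "inv f ` A" "inv f ` B"] A B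
    by (simp add: hull_dist_linear_ball[OF f] image_set_plus_linear[OF lin] compact_continuous_image cont)
qed

section \<open>Binary quadratic forms\<close>

text \<open>The triple \<open>(a, b, c)\<close> encodes the symmetric matrix with rows \<open>(a, b)\<close> and \<open>(b, c)\<close>.\<close>

definition quad :: "real \<times> real \<times> real \<Rightarrow> real^2 \<Rightarrow> real" where
  "quad p x = fst p * (x$1)\<^sup>2 + 2 * fst (snd p) * (x$1) * (x$2) + snd (snd p) * (x$2)\<^sup>2"

definition quad_trace :: "real \<times> real \<times> real \<Rightarrow> real" where
  "quad_trace p = fst p + snd (snd p)"

lemma quad_scale: "quad p (c *\<^sub>R x) = c\<^sup>2 * quad p x"
  by (simp add: quad_def power2_eq_square algebra_simps)

lemma quad_parallelogram: "quad p (x + y) + quad p (x - y) = 2 * quad p x + 2 * quad p y"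
  by (simp add: quad_def power2_eq_square algebra_simps)

lemma quad_add_scale: "quad (p + c *\<^sub>R q) x = quad p x + c * quad q x"
  by (simp add: quad_def algebra_simps)

lemma continuous_quad [continuous_intros]: "continuous_on S (quad p)"
  unfolding quad_def by (intro continuous_intros)

lemma norm_squared_2: "(norm (x :: real^2))\<^sup>2 = (x$1)\<^sup>2 + (x$2)\<^sup>2"
  unfolding power2_norm_eq_inner inner_vec_def sum_2 by (simp add: power2_eq_square)

text \<open>
  Completing the square, that is a Cholesky factorisation, writes the form as \<open>|g x|\<^sup>2\<close> with \<open>g\<close>
  linear and injective. Its pivots \<open>a\<close> and \<open>c - b\<^sup>2/a\<close> are positive because the form is positive at
  \<open>(1, 0)\<close> and at \<open>(b, -a)\<close>.
\<close>

lemma positive_quad_sublevel_ellipse: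
  assumes pos: "\<And>x. x \<noteq> 0 \<Longrightarrow> 0 < quad p x"
  shows "ellipse {x. quad p x \<le> 1}"
proof -
  obtain a b c where p: "p = (a, b, c)" by (metis surj_pair)
  define v1 v2 :: "real^2" where "v1 = vector [1, 0]" and "v2 = vector [b, - a]"
  have "v1 \<noteq> 0" by (simp add: v1_def vec_eq_iff forall_2)
  from pos[OF this] have a: "0 < a" by (simp add: quad_def p v1_def)
  then have "v2 \<noteq> 0" by (simp add: v2_def vec_eq_iff forall_2)
  from pos[OF this] have "0 < a * (a * c - b\<^sup>2)"
    by (simp add: quad_def p v2_def power2_eq_square algebra_simps)
  then have "0 < a * c - b\<^sup>2" using a by (simp add: zero_less_mult_iff)
  then have d: "0 < c - b\<^sup>2 / a" using a by (simp add: field_simps)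
  define g :: "real^2 \<Rightarrow> real^2"
    where "g x = vector [sqrt a * x$1 + b / sqrt a * x$2, sqrt (c - b\<^sup>2 / a) * x$2]" for x
  have lin: "linear g"
    by (rule linearI) (simp_all add: g_def vec_eq_iff forall_2 algebra_simps)
  have norm_g: "(norm (g x))\<^sup>2 = quad p x" for x
  proof -
    have "(norm (g x))\<^sup>2 = (sqrt a * x$1 + b / sqrt a * x$2)\<^sup>2 + (sqrt (c - b\<^sup>2 / a) * x$2)\<^sup>2"
      by (simp add: norm_squared_2 g_def)
    also have "(sqrt a * x$1 + b / sqrt a * x$2)\<^sup>2
        = (sqrt a)\<^sup>2 * (x$1)\<^sup>2 + 2 * b * (x$1) * (x$2) * (sqrt a / sqrt a) + b\<^sup>2 / (sqrt a)\<^sup>2 * (x$2)\<^sup>2"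
      by (simp add: power2_eq_square algebra_simps)
    also have "\<dots> = a * (x$1)\<^sup>2 + 2 * b * (x$1) * (x$2) + b\<^sup>2 / a * (x$2)\<^sup>2" using a by simp
    also have "(sqrt (c - b\<^sup>2 / a) * x$2)\<^sup>2 = (c - b\<^sup>2 / a) * (x$2)\<^sup>2"
      using d by (simp add: power_mult_distrib)
    finally show ?thesis by (simp add: quad_def p algebra_simps)
  qed
  have inj: "inj g"
  proof (subst linear_injective_0[OF lin], intro allI impI)
    fix x assume "g x = 0"
    then have "quad p x = 0" using norm_g[of x] by simp
    then show "x = 0" using pos[of x] by force
  qed
  have bij: "bij g"
    using inj linear_injective_imp_surjective[OF lin inj] by (simp add: bij_def)
  have "{x. quad p x \<le> 1} = (\<lambda>x. inv g x + 0) ` cball 0 1"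
  proof -
    have "quad p x \<le> 1 \<longleftrightarrow> g x \<in> cball 0 1" for x
      unfolding norm_g[symmetric] by (simp add: abs_square_le_1)
    then have "{x. quad p x \<le> 1} = g -` cball 0 1" by (simp only: vimage_def)
    also have "\<dots> = inv g ` cball 0 1" by (rule bij_vimage_eq_inv_image[OF bij])
    finally show ?thesis by simp
  qed
  moreover have "linear (inv g)" "bij (inv g)"
    using lin inj bij by (auto intro: inj_linear_imp_inv_linear bij_imp_bij_inv)
  ultimately show ?thesis unfolding ellipse_def by blast
qed

section \<open>The norm of a symmetric convex body\<close>

locale symmetric_body =
  fixes K :: "(real^2) set"
  assumes body: "convex_body K" and sym: "origin_symmetric K"
begin

abbreviation N :: "real^2 \<Rightarrow> real" where "N \<equiv> body_norm K"

lemma uminus_mem: "x \<in> K \<Longrightarrow> - x \<in> K"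
  using sym by (auto simp: origin_symmetric_def)

lemma contains_ball: obtains r where "r > 0" "cball 0 r \<subseteq> K"
proof -
  obtain y where "y \<in> interior K" using body by (auto simp: convex_body_def)
  then obtain r where r: "r > 0" "cball y r \<subseteq> K" by (auto simp: mem_interior_cball)
  \<comment> \<open>A ball around \<open>y\<close> and its reflection around \<open>-y\<close> average to a ball around the origin.\<close>
  have "cball 0 r \<subseteq> K"
  proof
    fix x :: "real^2" assume "x \<in> cball 0 r"
    then have "y + x \<in> K" "y - x \<in> K" using r(2) by (auto simp: dist_norm)
    then have "y + x \<in> K" "x - y \<in> K" using uminus_mem[of "y - x"] by simp_all
    then have "(1/2) *\<^sub>R (y + x) + (1/2) *\<^sub>R (x - y) \<in> K"
      using body by (intro convexD) (auto simp: convex_body_def)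
    also have "(1/2) *\<^sub>R (y + x) + (1/2) *\<^sub>R (x - y) = (1/2) *\<^sub>R (x + x)"
      by (simp flip: scaleR_add_right)
    also have "\<dots> = x" by (rule scaleR_half_double)
    finally show "x \<in> K" .
  qed
  then show thesis using that r(1) by blast
qed

lemma zero_mem: "0 \<in> K"
proof -
  obtain r where "r > 0" "cball 0 r \<subseteq> K" by (rule contains_ball)
  then show ?thesis by auto
qed

lemma mem_scaled: "l > 0 \<Longrightarrow> x \<in> (\<lambda>y. l *\<^sub>R y) ` K \<longleftrightarrow> (1 / l) *\<^sub>R x \<in> K"
  by (auto simp: image_iff intro!: bexI[of _ "(1 / l) *\<^sub>R x"])

lemma N_alt: "N x = Inf {l. l > 0 \<and> (1 / l) *\<^sub>R x \<in> K}"
  unfolding body_norm_def by (rule arg_cong[of _ _ Inf]) (use mem_scaled in auto)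

lemma N_le: "l > 0 \<Longrightarrow> (1 / l) *\<^sub>R x \<in> K \<Longrightarrow> N x \<le> l"
  unfolding N_alt by (rule cInf_lower) (auto intro!: bdd_belowI[of _ 0])

lemma scale_down:
  assumes "y \<in> K" "0 \<le> c" "c \<le> 1"
  shows "c *\<^sub>R y \<in> K"
proof -
  have "c *\<^sub>R y + (1 - c) *\<^sub>R 0 \<in> K"
    using body zero_mem assms by (intro convexD) (auto simp: convex_body_def)
  then show ?thesis by simp
qed

lemma gauge_set_nonempty: "{l. l > 0 \<and> (1 / l) *\<^sub>R x \<in> K} \<noteq> {}"
proof -
  obtain r where r: "r > 0" "cball 0 r \<subseteq> K" by (rule contains_ball)
  define l where "l = norm x / r + 1"
  have "l > 0" using r(1) by (simp add: l_def add_nonneg_pos)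
  moreover have "r * l = norm x + r" using r(1) by (simp add: l_def distrib_left)
  ultimately have "norm ((1 / l) *\<^sub>R x) \<le> r" using r(1) by (simp add: pos_divide_le_eq)
  then have "(1 / l) *\<^sub>R x \<in> K" by (intro subsetD[OF r(2)]) simp
  then show ?thesis using \<open>l > 0\<close> by blast
qed

lemma N_nonneg: "0 \<le> N x"
  unfolding N_alt by (rule cInf_greatest) (use gauge_set_nonempty in auto)

lemma N_less_imp_mem:
  assumes "N x < l"
  shows "(1 / l) *\<^sub>R x \<in> K"
proof -
  obtain k where k: "k > 0" "(1 / k) *\<^sub>R x \<in> K" "k < l"
    using cInf_lessD[OF gauge_set_nonempty] assms unfolding N_alt by blast
  have "(k / l) *\<^sub>R ((1 / k) *\<^sub>R x) \<in> K" using k by (intro scale_down[of "(1 / k) *\<^sub>R x"]) auto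
  then show ?thesis using k by simp
qed

lemma N_le_norm: "\<exists>C>0. \<forall>x. N x \<le> C * norm x"
proof -
  obtain r where r: "r > 0" "cball 0 r \<subseteq> K" by (rule contains_ball)
  have "N x \<le> (1 / r) * norm x" for x
  proof (rule field_le_epsilon)
    fix e :: real assume "e > 0"
    define l where "l = (1 / r) * norm x + e"
    have l: "l > 0" using r \<open>e > 0\<close> by (auto simp: l_def intro: add_nonneg_pos)
    have "norm x \<le> r * l" using r \<open>e > 0\<close> by (simp add: l_def field_simps)
    then have "(1 / l) *\<^sub>R x \<in> K" using r(2) l by (intro subsetD[OF r(2)]) (simp add: field_simps)
    then show "N x \<le> (1 / r) * norm x + e" using N_le l l_def by simp
  qed
  then show ?thesis using r by (intro exI[of _ "1 / r"]) simp
qed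

lemma norm_le_N: "\<exists>C>0. \<forall>x. norm x \<le> C * N x"
proof -
  obtain R where R: "\<And>x. x \<in> K \<Longrightarrow> norm x \<le> R" "R > 0"
    using body compact_imp_bounded bounded_pos unfolding convex_body_def by metis
  have "norm x \<le> R * N x" for x
  proof (rule field_le_epsilon)
    fix e :: real assume "e > 0"
    define l where "l = N x + e / R"
    have l: "N x < l" using R \<open>e > 0\<close> by (simp add: l_def)
    then have "l > 0" using N_nonneg[of x] by linarith
    have "norm ((1 / l) *\<^sub>R x) \<le> R" using R(1) N_less_imp_mem[OF l] by blast
    then have "norm x \<le> R * l" using \<open>l > 0\<close> by (simp add: field_simps)
    also have "R * l = R * N x + e" using R by (simp add: l_def distrib_left)
    finally show "norm x \<le> R * N x + e" .
  qed
  then show ?thesis using R by blast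
qed

lemma N_zero [simp]: "N 0 = 0"
proof -
  obtain C where "C > 0" "\<And>x. N x \<le> C * norm x" using N_le_norm by blast
  from this(2)[of 0] N_nonneg[of 0] show ?thesis by simp
qed

lemma N_pos: "x \<noteq> 0 \<Longrightarrow> 0 < N x"
proof -
  assume "x \<noteq> 0"
  obtain C where C: "C > 0" "\<And>x. norm x \<le> C * N x" using norm_le_N by blast
  have "0 < C * N x" using C(2)[of x] \<open>x \<noteq> 0\<close> by (meson less_le_trans zero_less_norm_iff)
  then show ?thesis using C(1) by (simp add: zero_less_mult_iff)
qed

lemma N_scale_le: "N (c *\<^sub>R x) \<le> \<bar>c\<bar> * N x"
proof (cases "c = 0")
  case False
  show ?thesis
  proof (rule field_le_epsilon)
    fix e :: real assume "e > 0"
    define l where "l = N x + e / \<bar>c\<bar>"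
    have l: "N x < l" using False \<open>e > 0\<close> by (simp add: l_def)
    then have "l > 0" using N_nonneg[of x] by linarith
    have "(1 / l) *\<^sub>R x \<in> K" using N_less_imp_mem[OF l] .
    then have "(sgn c) *\<^sub>R ((1 / l) *\<^sub>R x) \<in> K" using uminus_mem False by (cases "c > 0") (auto simp: sgn_if)
    moreover have "(sgn c) *\<^sub>R ((1 / l) *\<^sub>R x) = (1 / (\<bar>c\<bar> * l)) *\<^sub>R (c *\<^sub>R x)"
      using False by (simp add: sgn_if abs_if)
    ultimately have "(1 / (\<bar>c\<bar> * l)) *\<^sub>R (c *\<^sub>R x) \<in> K" by (simp only:)
    moreover have "\<bar>c\<bar> * l > 0" using False \<open>l > 0\<close> by simp
    ultimately have "N (c *\<^sub>R x) \<le> \<bar>c\<bar> * l" by (intro N_le)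
    also have "\<bar>c\<bar> * l = \<bar>c\<bar> * N x + e" using False by (simp add: l_def distrib_left)
    finally show "N (c *\<^sub>R x) \<le> \<bar>c\<bar> * N x + e" .
  qed
qed simp

lemma N_scale: "N (c *\<^sub>R x) = \<bar>c\<bar> * N x"
proof (cases "c = 0")
  case False
  have "N x = N ((1 / c) *\<^sub>R (c *\<^sub>R x))" using False by simp
  also have "\<dots> \<le> \<bar>1 / c\<bar> * N (c *\<^sub>R x)" by (rule N_scale_le)
  finally have "\<bar>c\<bar> * N x \<le> N (c *\<^sub>R x)" using False by (simp add: field_simps)
  then show ?thesis using N_scale_le[of c x] by simp
qed simp

lemma N_uminus: "N (- x) = N x"
  using N_scale[of "-1" x] by simp

lemma N_triangle: "N (x + y) \<le> N x + N y"
proof (rule field_le_epsilon)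
  fix e :: real assume "e > 0"
  define k l where "k = N x + e / 2" and "l = N y + e / 2"
  have kl: "N x < k" "N y < l" using \<open>e > 0\<close> by (auto simp: k_def l_def)
  then have pos: "k > 0" "l > 0" using N_nonneg[of x] N_nonneg[of y] by linarith+
  define u where "u = k / (k + l)"
  have u: "0 \<le> u" "u \<le> 1" "u * (1 / k) = 1 / (k + l)" "(1 - u) * (1 / l) = 1 / (k + l)"
    using pos by (auto simp: u_def field_simps)
  have "u *\<^sub>R ((1 / k) *\<^sub>R x) + (1 - u) *\<^sub>R ((1 / l) *\<^sub>R y) \<in> K"
    using body u N_less_imp_mem[OF kl(1)] N_less_imp_mem[OF kl(2)]
    by (intro convexD) (auto simp: convex_body_def)
  then have "(1 / (k + l)) *\<^sub>R (x + y) \<in> K"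
    by (simp only: scaleR_scaleR u scaleR_add_right)
  then have "N (x + y) \<le> k + l" using N_le pos by simp
  then show "N (x + y) \<le> N x + N y + e" by (simp add: k_def l_def)
qed

lemma continuous_N: "continuous_on S N"
proof -
  obtain C where C: "C > 0" "\<And>x. N x \<le> C * norm x" using N_le_norm by blast
  have diff: "\<bar>N x - N y\<bar> \<le> C * norm (x - y)" for x y
  proof -
    have "N x \<le> N (x - y) + N y" "N y \<le> N (y - x) + N x"
      using N_triangle[of "x - y" y] N_triangle[of "y - x" x] by simp_all
    moreover have "N (y - x) = N (x - y)" using N_uminus[of "x - y"] by simp
    ultimately show ?thesis using C(2)[of "x - y"] by linarith
  qed
  have "C-lipschitz_on S N"
    by (rule lipschitz_onI) (use diff C(1) in \<open>auto simp: dist_norm\<close>)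
  then show ?thesis by (rule lipschitz_on_continuous_on)
qed

lemma mem_iff_N: "x \<in> K \<longleftrightarrow> N x \<le> 1"
proof
  assume "x \<in> K" then show "N x \<le> 1" using N_le[of 1 x] by simp
next
  assume le: "N x \<le> 1"
  \<comment> \<open>The scaled points have norm below 1 and so lie in \<open>K\<close>; the limit does because \<open>K\<close> is closed.\<close>
  have "(\<lambda>n. 1 / real (Suc n)) \<longlonglongrightarrow> 0"
    using LIMSEQ_inverse_real_of_nat by (simp add: inverse_eq_divide)
  then have lim: "(\<lambda>n. (1 - 1 / real (Suc n)) *\<^sub>R x) \<longlonglongrightarrow> (1 - 0) *\<^sub>R x"
    by (rule tendsto_scaleR[OF tendsto_diff[OF tendsto_const] tendsto_const])
  have mem: "(1 - 1 / real (Suc n)) *\<^sub>R x \<in> K" for n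
  proof -
    define c where "c = 1 - 1 / real (Suc n)"
    have c: "0 \<le> c" "c < 1" by (simp_all add: c_def divide_le_eq_1)
    have "N (c *\<^sub>R x) = c * N x" using c(1) by (simp add: N_scale)
    also have "\<dots> \<le> c * 1" using le c(1) by (rule mult_left_mono)
    also have "\<dots> < 1" using c(2) by simp
    finally show ?thesis using N_less_imp_mem[of "c *\<^sub>R x" 1] by (simp add: c_def)
  qed
  have "closed K" using body by (simp add: convex_body_def compact_imp_closed)
  from closed_sequentially[OF this mem lim] have "(1 - 0) *\<^sub>R x \<in> K" .
  then show "x \<in> K" by simp
qed

section \<open>The parallelogram test\<close>

lemma N_minus_commute: "N (x - y) = N (y - x)"
  using N_uminus[of "x - y"] by simp

lemma hull_dist_two_points_le: "hull_dist K {0, 2 *\<^sub>R u} \<le> N u"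
  unfolding hull_dist_def
proof (rule cSUP_least)
  fix x assume "x \<in> convex hull {0, 2 *\<^sub>R u}"
  then obtain t where t: "0 \<le> t" "t \<le> 1" "x = t *\<^sub>R (2 *\<^sub>R u)"
    by (auto simp: segment_convex_hull[symmetric] in_segment)
  have bdd: "bdd_below ((\<lambda>s. N (x - s)) ` {0, 2 *\<^sub>R u})" by (intro bdd_below_finite) simp
  show "(INF s\<in>{0, 2 *\<^sub>R u}. N (x - s)) \<le> N u"
  proof (cases "t \<le> 1/2")
    case True
    have "x - 0 = (2 * t) *\<^sub>R u" by (simp add: t mult.commute)
    then have "N (x - 0) = 2 * t * N u" using t(1) by (simp only: N_scale)
    also have "\<dots> \<le> 1 * N u" using True N_nonneg by (intro mult_right_mono) auto
    finally show ?thesis using cINF_lower2[OF bdd, of 0] by simp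
  next
    case False
    have "x - 2 *\<^sub>R u = (2 * t - 2) *\<^sub>R u"
      unfolding t scaleR_scaleR by (simp only: scaleR_left_diff_distrib mult.commute)
    then have "N (x - 2 *\<^sub>R u) = (2 - 2 * t) * N u" using t(2) by (simp only: N_scale) simp
    also have "\<dots> \<le> 1 * N u" using False N_nonneg by (intro mult_right_mono) auto
    finally show ?thesis using cINF_lower2[OF bdd, of "2 *\<^sub>R u"] by simp
  qed
qed simp

lemma hull_dist_ge:
  assumes fin: "finite S" and x: "x \<in> convex hull S"
  shows "(INF s\<in>S. N (x - s)) \<le> hull_dist K S"
proof -
  obtain s0 where s0: "s0 \<in> S" using x by (cases "S = {}") auto
  have "compact (convex hull S)" using fin by (rule finite_imp_compact_convex_hull)
  then have "compact ((\<lambda>y. N (y - s0)) ` (convex hull S))"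
    by (intro compact_continuous_image continuous_on_compose2[OF continuous_N[of UNIV]] continuous_intros) auto
  then have "bdd_above ((\<lambda>y. N (y - s0)) ` (convex hull S))"
    by (rule bounded_imp_bdd_above[OF compact_imp_bounded])
  moreover have "(INF s\<in>S. N (y - s)) \<le> N (y - s0)" for y
    using fin s0 by (intro cINF_lower) auto
  ultimately have "bdd_above ((\<lambda>y. INF s\<in>S. N (y - s)) ` (convex hull S))"
    unfolding bdd_above_def by (auto intro: order_trans)
  then show ?thesis unfolding hull_dist_def using x by (rule cSUP_upper2) auto
qed

lemma hull_dist_nonneg:
  assumes "finite S" "S \<noteq> {}"
  shows "0 \<le> hull_dist K S"
proof -
  obtain s where s: "s \<in> S" using assms(2) by blast
  have "0 \<le> (INF y\<in>S. N (s - y))" using assms(2) N_nonneg by (intro cINF_greatest) auto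
  also have "\<dots> \<le> hull_dist K S" using assms(1) s by (intro hull_dist_ge hull_inc)
  finally show ?thesis .
qed

text \<open>
  The sum of the pairs \<open>{0, 2u}\<close> and \<open>{0, 2v}\<close> is the vertex set of a parallelogram with centre
  \<open>u + v\<close>, whose distances to the vertices are \<open>N (u + v)\<close> and \<open>N (u - v)\<close>.
\<close>

lemma subadditive_imp_min_diagonal:
  assumes sub: "\<forall>A B. compact A \<and> A \<noteq> {} \<and> compact B \<and> B \<noteq> {} \<longrightarrow>
      (hull_dist K (A + B))\<^sup>2 \<le> (hull_dist K A)\<^sup>2 + (hull_dist K B)\<^sup>2"
  shows "(min (N (u + v)) (N (u - v)))\<^sup>2 \<le> (N u)\<^sup>2 + (N v)\<^sup>2"
proof -
  define A B where "A = {0, 2 *\<^sub>R u}" and "B = {0, 2 *\<^sub>R v}"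
  have sum: "A + B = {0, 2 *\<^sub>R u, 2 *\<^sub>R v, 2 *\<^sub>R u + 2 *\<^sub>R v}"
    by (auto simp: A_def B_def set_plus_def)
  have "u \<in> convex hull A" "v \<in> convex hull B"
    unfolding A_def B_def segment_convex_hull[symmetric] in_segment
    by (auto intro!: exI[of _ "1/2"])
  then have mid: "u + v \<in> convex hull (A + B)"
    by (simp add: convex_hull_set_plus set_plus_intro)
  have "min (N (u + v)) (N (u - v)) \<le> (INF s\<in>A + B. N (u + v - s))"
  proof (rule cINF_greatest)
    fix s assume "s \<in> A + B"
    then consider "u + v - s = u + v" | "u + v - s = v - u" | "u + v - s = u - v" | "u + v - s = - (u + v)"
      unfolding sum by (auto simp: scaleR_2)
    then show "min (N (u + v)) (N (u - v)) \<le> N (u + v - s)"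
      by cases (use N_minus_commute[of u v] N_uminus[of "u + v"] in \<open>simp_all only: min.cobounded1 min.cobounded2\<close>)
  qed (simp add: sum)
  also have "\<dots> \<le> hull_dist K (A + B)"
    using mid by (intro hull_dist_ge) (simp_all add: sum)
  finally have "(min (N (u + v)) (N (u - v)))\<^sup>2 \<le> (hull_dist K (A + B))\<^sup>2"
    by (intro power_mono) (simp_all add: N_nonneg)
  also have "\<dots> \<le> (hull_dist K A)\<^sup>2 + (hull_dist K B)\<^sup>2"
    using sub by (auto simp: A_def B_def)
  also have "\<dots> \<le> (N u)\<^sup>2 + (N v)\<^sup>2"
    by (intro add_mono power_mono) (simp_all add: A_def B_def hull_dist_two_points_le hull_dist_nonneg)
  finally show ?thesis .
qed

text \<open>
  With the sides \<open>s + t\<close> and \<open>s - t\<close> the two diagonals are \<open>2s\<close> and \<open>2t\<close>, of equal norm, so the minimum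
  in the parallelogram test is \<open>2 N s\<close>. The parallelogram law for the form, evaluated at contact points, gives
  the reverse inequality, and equality must hold in each majorisation.
\<close>

lemma contact_sum:
  assumes diag: "\<And>u v. (min (N (u + v)) (N (u - v)))\<^sup>2 \<le> (N u)\<^sup>2 + (N v)\<^sup>2"
    and major: "\<And>x. (N x)\<^sup>2 \<le> quad p x"
    and s: "(N s)\<^sup>2 = quad p s" and t: "(N t)\<^sup>2 = quad p t" and eq: "N s = N t"
  shows "(N (s + t))\<^sup>2 = quad p (s + t)"
proof -
  have "(s + t) + (s - t) = 2 *\<^sub>R s" "(s + t) - (s - t) = 2 *\<^sub>R t" by (simp_all add: scaleR_2)
  then have "(2 * N s)\<^sup>2 \<le> (N (s + t))\<^sup>2 + (N (s - t))\<^sup>2"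
    using diag[of "s + t" "s - t"] eq by (simp add: N_scale)
  moreover have "quad p (s + t) + quad p (s - t) = (2 * N s)\<^sup>2"
    using quad_parallelogram[of p s t] s t eq by (simp add: power2_eq_square)
  ultimately show ?thesis using major[of "s + t"] major[of "s - t"] by linarith
qed

text \<open>
  Sums of equal-norm members bisect, up to scaling, the angle between two members. If the segment
  from \<open>s\<close> to \<open>t\<close> had its midpoint outside \<open>C\<close>, the gap of \<open>C\<close> around that midpoint would have two
  end points in \<open>C\<close>, whose bisector would fall inside the gap.
\<close>

lemma closed_cone_sum:
  assumes closed: "closed C"
    and scale: "\<And>c x. x \<in> C \<Longrightarrow> c *\<^sub>R x \<in> C"
    and add: "\<And>x y. x \<in> C \<Longrightarrow> y \<in> C \<Longrightarrow> N x = N y \<Longrightarrow> x + y \<in> C"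
    and s: "s \<in> C" and t: "t \<in> C"
  shows "s + t \<in> C"
proof -
  define z where "z l = (1 - l) *\<^sub>R s + l *\<^sub>R t" for l :: real
  define L where "L = {l. z l \<in> C}"
  have "closed (z -` C)"
    unfolding z_def by (intro closed_vimage closed continuous_intros)
  then have L: "closed L" by (simp add: L_def vimage_def)
  have half: "1/2 \<in> L" if nz: "\<And>l. 0 \<le> l \<Longrightarrow> l \<le> 1 \<Longrightarrow> z l \<noteq> 0"
  proof (rule ccontr)
    assume no: "1/2 \<notin> L"
    have "compact ({0..1/2} \<inter> L)" "0 \<in> {0..1/2} \<inter> L"
      using L s by (auto simp: L_def z_def intro!: compact_Int_closed)
    then obtain l1 where l1: "l1 \<in> {0..1/2} \<inter> L" "\<And>l. l \<in> {0..1/2} \<inter> L \<Longrightarrow> l \<le> l1"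
      using compact_attains_sup[of "{0..1/2} \<inter> L"] by blast
    have "compact ({1/2..1} \<inter> L)" "1 \<in> {1/2..1} \<inter> L"
      using L t by (auto simp: L_def z_def intro!: compact_Int_closed)
    then obtain l2 where l2: "l2 \<in> {1/2..1} \<inter> L" "\<And>l. l \<in> {1/2..1} \<inter> L \<Longrightarrow> l2 \<le> l"
      using compact_attains_inf[of "{1/2..1} \<inter> L"] by blast
    have "l1 \<noteq> 1/2" "l2 \<noteq> 1/2" using l1(1) l2(1) no by (metis Int_iff)+
    then have rng: "0 \<le> l1" "l1 < 1/2" "1/2 < l2" "l2 \<le> 1" and mem: "z l1 \<in> C" "z l2 \<in> C"
      using l1(1) l2(1) by (auto simp: L_def)
    define n1 n2 where "n1 = N (z l1)" and "n2 = N (z l2)"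
    have n: "0 < n1" "0 < n2" using nz rng by (auto simp: n1_def n2_def intro!: N_pos)
    \<comment> \<open>Weights inversely proportional to the norms, so that the weighted end points have equal norm.\<close>
    define k where "k = n2 / (n1 + n2)"
    have k: "0 < k" "k < 1" using n by (auto simp: k_def field_simps)
    define l where "l = (1 - k) * l2 + k * l1"
    have "N (n2 *\<^sub>R z l1) = N (n1 *\<^sub>R z l2)" using n by (simp add: N_scale n1_def n2_def)
    then have "n2 *\<^sub>R z l1 + n1 *\<^sub>R z l2 \<in> C" using mem by (intro add scale)
    then have "(1 / (n1 + n2)) *\<^sub>R (n2 *\<^sub>R z l1 + n1 *\<^sub>R z l2) \<in> C" by (rule scale)
    moreover have "1 - k = n1 / (n1 + n2)" using n by (simp add: k_def field_simps)
    ultimately have "k *\<^sub>R z l1 + (1 - k) *\<^sub>R z l2 \<in> C" by (simp add: scaleR_add_right k_def)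
    also have "k *\<^sub>R z l1 + (1 - k) *\<^sub>R z l2 = z l"
      by (simp add: z_def l_def algebra_simps)
    finally have lL: "l \<in> L" by (simp add: L_def)
    have diff: "l - l1 = (1 - k) * (l2 - l1)" "l2 - l = k * (l2 - l1)"
      by (simp_all add: l_def algebra_simps)
    have "0 < l - l1" "0 < l2 - l" unfolding diff using k rng by auto
    then have "l1 < l" "l < l2" by simp_all
    then show False using l1(2)[of l] l2(2)[of l] lL rng by (cases "l \<le> 1/2") auto
  qed
  show ?thesis
  proof (cases "\<exists>l. 0 \<le> l \<and> l \<le> 1 \<and> z l = 0")
    \<comment> \<open>The segment passes through the origin only if \<open>s\<close> and \<open>t\<close> are linearly dependent.\<close>
    case True
    then obtain l where l: "(1 - l) *\<^sub>R s + l *\<^sub>R t = 0" by (auto simp: z_def)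
    show ?thesis
    proof (cases "l = 0")
      case True
      then have "s = 0" using l by simp
      then show ?thesis using t by simp
    next
      case False
      have "l *\<^sub>R (s + t) = (l - k) *\<^sub>R s + (k *\<^sub>R s + l *\<^sub>R t)" for k
        by (simp add: scaleR_add_right scaleR_left_diff_distrib)
      from this[of "1 - l"] have "l *\<^sub>R (s + t) = (l - (1 - l)) *\<^sub>R s" by (simp only: l add_0_right)
      then have "l *\<^sub>R (s + t) \<in> C" using scale[OF s] by (simp only:)
      then have "(1 / l) *\<^sub>R (l *\<^sub>R (s + t)) \<in> C" by (rule scale)
      then show ?thesis using False by simp
    qed
  next
    case False
    then have "z (1/2) \<in> C" using half by (auto simp: L_def)
    then have "2 *\<^sub>R z (1/2) \<in> C" by (rule scale)
    then show ?thesis by (simp add: z_def scaleR_add_right)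
  qed
qed

section \<open>Majorising forms of minimal trace\<close>

text \<open>
  A form above \<open>N\<^sup>2\<close> is nonnegative, and for such a form a bound on the trace bounds all coefficients;
  hence the minimum is taken over a compact set.
\<close>

lemma minimal_trace_quad:
  obtains p where "\<And>x. (N x)\<^sup>2 \<le> quad p x"
    "\<And>q. (\<And>x. (N x)\<^sup>2 \<le> quad q x) \<Longrightarrow> quad_trace p \<le> quad_trace q"
proof -
  define F where "F = {p. \<forall>x. (N x)\<^sup>2 \<le> quad p x}"
  obtain C where C: "C > 0" "\<And>x. N x \<le> C * norm x" using N_le_norm by blast
  define p0 where "p0 = (C\<^sup>2, 0 :: real, C\<^sup>2)"
  have p0: "p0 \<in> F"
  proof -
    have "(N x)\<^sup>2 \<le> quad p0 x" for x
    proof -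
      have "(N x)\<^sup>2 \<le> (C * norm x)\<^sup>2" using C N_nonneg by (intro power_mono) auto
      also have "\<dots> = quad p0 x" by (simp add: quad_def p0_def power_mult_distrib norm_squared_2 algebra_simps)
      finally show ?thesis .
    qed
    then show ?thesis by (simp add: F_def)
  qed
  have "closed F"
    unfolding F_def quad_def by (intro closed_Collect_all closed_Collect_le continuous_intros)
  moreover have "closed {p. quad_trace p \<le> quad_trace p0}"
    unfolding quad_trace_def by (intro closed_Collect_le continuous_intros)
  ultimately have cl: "closed (F \<inter> {p. quad_trace p \<le> quad_trace p0})" by (rule closed_Int)
  define M where "M = quad_trace p0"
  have box: "F \<inter> {p. quad_trace p \<le> quad_trace p0} \<subseteq> {0..M} \<times> {-M..M} \<times> {0..M}"
  proof
    fix p assume p: "p \<in> F \<inter> {p. quad_trace p \<le> quad_trace p0}"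
    obtain a b c where abc: "p = (a, b, c)" by (metis surj_pair)
    have nn: "0 \<le> quad p x" for x 
    proof -
      have "0 \<le> (N x)\<^sup>2" by simp
      also have "\<dots> \<le> quad p x" using p by (simp add: F_def)
      finally show ?thesis .
    qed
    have "0 \<le> a" using nn[of "vector [1, 0]"] by (simp add: quad_def abc)
    moreover have "0 \<le> c" using nn[of "vector [0, 1]"] by (simp add: quad_def abc)
    moreover have "0 \<le> a + 2 * b + c" using nn[of "vector [1, 1]"] by (simp add: quad_def abc)
    moreover have "0 \<le> a - 2 * b + c" using nn[of "vector [1, -1]"] by (simp add: quad_def abc)
    moreover have "a + c \<le> M" using p by (simp add: M_def quad_trace_def abc)
    ultimately show "p \<in> {0..M} \<times> {-M..M} \<times> {0..M}" by (simp add: abc)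
  qed
  have "compact (({0..M} \<times> {-M..M} \<times> {0..M}) \<inter> (F \<inter> {p. quad_trace p \<le> quad_trace p0}))"
    by (intro compact_Int_closed compact_Times compact_Icc cl)
  then have "compact (F \<inter> {p. quad_trace p \<le> quad_trace p0})" using box by (simp add: Int_absorb1)
  moreover have "p0 \<in> F \<inter> {p. quad_trace p \<le> quad_trace p0}" using p0 by simp
  moreover have "continuous_on (F \<inter> {p. quad_trace p \<le> quad_trace p0}) quad_trace"
    unfolding quad_trace_def by (intro continuous_intros)
  ultimately obtain p where p: "p \<in> F" "\<And>q. q \<in> F \<Longrightarrow> quad_trace q \<le> quad_trace p0 \<Longrightarrow> quad_trace p \<le> quad_trace q"
    "quad_trace p \<le> quad_trace p0"
    using continuous_attains_inf[of "F \<inter> {p. quad_trace p \<le> quad_trace p0}" quad_trace] by blast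
  then have "quad_trace p \<le> quad_trace q" if "q \<in> F" for q
    using that by (cases "quad_trace q \<le> quad_trace p0") auto
  then show thesis using that[of p] p(1) by (simp add: F_def quad_trace_def)
qed

text \<open>
  If all contact points were orthogonal to \<open>a\<close>, the form \<open>r x = |a|\<^sup>2 |x|\<^sup>2 - 3 (a \<bullet> x)\<^sup>2\<close> would be positive
  at each nonzero one, so by compactness adding a small multiple of \<open>r\<close> would keep the form above \<open>N\<^sup>2\<close>. But
  the trace of \<open>r\<close> is \<open>2 |a|\<^sup>2 - 3 |a|\<^sup>2 < 0\<close>; any factor greater than 2 in place of 3 would do.
\<close>

lemma minimal_trace_contact_off_line:
  assumes major: "\<And>x. (N x)\<^sup>2 \<le> quad p x"
    and minimal: "\<And>q. (\<And>x. (N x)\<^sup>2 \<le> quad q x) \<Longrightarrow> quad_trace p \<le> quad_trace q"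
    and a: "a \<noteq> 0"
  obtains x where "(N x)\<^sup>2 = quad p x" "a \<bullet> x \<noteq> 0"
proof (rule ccontr)
  assume no: "\<not> thesis"
  have contact: "a \<bullet> x = 0" if "(N x)\<^sup>2 = quad p x" for x
    using that no \<open>\<And>x. (N x)\<^sup>2 = quad p x \<Longrightarrow> a \<bullet> x \<noteq> 0 \<Longrightarrow> thesis\<close> by blast
  define n where "n = (norm a)\<^sup>2"
  have n: "0 < n" using a by (simp add: n_def)
  define r where "r = (n - 3 * (a$1)\<^sup>2, - 3 * (a$1) * (a$2), n - 3 * (a$2)\<^sup>2)"
  have r: "quad r x = n * (norm x)\<^sup>2 - 3 * (a \<bullet> x)\<^sup>2" for x
    unfolding quad_def r_def norm_squared_2 inner_vec_def sum_2
    by (simp add: power2_eq_square algebra_simps)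
  have r_lower: "- 2 * n * (norm x)\<^sup>2 \<le> quad r x" for x
    using Cauchy_Schwarz_ineq[of a x] unfolding r n_def by (simp add: power2_norm_eq_inner)
  define S where "S = sphere (0 :: real^2) 1 \<inter> {x. quad r x \<le> 0}"
  define h where "h x = quad p x - (N x)\<^sup>2" for x
  have "compact S"
    unfolding S_def by (intro compact_Int_closed compact_sphere closed_Collect_le continuous_intros)
  have cont_h: "continuous_on S h"
    unfolding h_def by (intro continuous_intros continuous_N)
  have h_pos: "0 < h x" if "x \<in> S" for x
  proof (rule ccontr)
    assume "\<not> 0 < h x"
    then have "(N x)\<^sup>2 = quad p x" using major[of x] by (simp add: h_def)
    then have "quad r x = n" using contact[of x] that by (simp add: r S_def)
    then show False using that n by (simp add: S_def)
  qed
  obtain d where d: "0 < d" "\<And>x. x \<in> S \<Longrightarrow> d \<le> h x"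
  proof (cases "S = {}")
    case True then show thesis using that[of 1] by simp
  next
    case False
    then obtain x where "x \<in> S" "\<And>y. y \<in> S \<Longrightarrow> h x \<le> h y"
      using continuous_attains_inf[OF \<open>compact S\<close> _ cont_h] by blast
    then show thesis using that[of "h x"] h_pos by blast
  qed
  \<comment> \<open>On the unit circle \<open>r \<ge> -2n\<close>, so this multiple of \<open>r\<close> costs at most the slack \<open>d\<close>.\<close>
  define e where "e = d / (2 * n)"
  have e: "0 < e" "e * (2 * n) = d" using d n by (auto simp: e_def)
  have unit: "(N x)\<^sup>2 \<le> quad (p + e *\<^sub>R r) x" if "norm x = 1" for x
  proof (cases "quad r x \<le> 0")
    case True
    then have "d \<le> h x" using that d(2) by (simp add: S_def)
    moreover have "e * (- 2 * n) \<le> e * quad r x"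
      using e(1) r_lower[of x] that by (intro mult_left_mono) auto
    then have "- d \<le> e * quad r x" using e(2) by simp
    ultimately show ?thesis by (simp add: quad_add_scale h_def)
  next
    case False
    then have "0 \<le> e * quad r x" using e(1) by simp
    then show ?thesis using major[of x] by (simp add: quad_add_scale)
  qed
  have "(N x)\<^sup>2 \<le> quad (p + e *\<^sub>R r) x" for x
  proof (cases "x = 0")
    case False
    define y where "y = (1 / norm x) *\<^sub>R x"
    have y: "norm y = 1" "x = norm x *\<^sub>R y" using False by (auto simp: y_def)
    have "(N x)\<^sup>2 = (norm x)\<^sup>2 * (N y)\<^sup>2"
      by (subst y(2)) (simp add: N_scale power_mult_distrib)
    also have "\<dots> \<le> (norm x)\<^sup>2 * quad (p + e *\<^sub>R r) y"
      using unit[OF y(1)] by (intro mult_left_mono) auto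
    also have "\<dots> = quad (p + e *\<^sub>R r) (norm x *\<^sub>R y)" by (simp only: quad_scale)
    also have "norm x *\<^sub>R y = x" by (rule y(2)[symmetric])
    finally show ?thesis .
  qed (simp add: quad_def)
  from minimal[OF this] have "0 \<le> e * quad_trace r" by (simp add: quad_trace_def algebra_simps)
  moreover have "quad_trace r = - n" by (simp add: quad_trace_def r_def n_def norm_squared_2)
  ultimately have "e * n \<le> 0" by simp
  then show False using e(1) n by (simp add: mult_le_0_iff)
qed

section \<open>The characterisation of ellipses\<close>

theorem min_diagonal_imp_ellipse:
  assumes diag: "\<And>u v. (min (N (u + v)) (N (u - v)))\<^sup>2 \<le> (N u)\<^sup>2 + (N v)\<^sup>2"
  shows "ellipse K"
proof -
  obtain p where major: "\<And>x. (N x)\<^sup>2 \<le> quad p x"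
    and minimal: "\<And>q. (\<And>x. (N x)\<^sup>2 \<le> quad q x) \<Longrightarrow> quad_trace p \<le> quad_trace q"
    using minimal_trace_quad by metis
  define C where "C = {x. (N x)\<^sup>2 = quad p x}"
  have closed: "closed C"
    unfolding C_def by (intro closed_Collect_eq continuous_intros continuous_N)
  have scale: "c *\<^sub>R x \<in> C" if "x \<in> C" for c x
    using that by (simp add: C_def N_scale quad_scale power_mult_distrib)
  have add: "x + y \<in> C" if "x \<in> C" "y \<in> C" "N x = N y" for x y
    using contact_sum[OF diag major] that by (simp add: C_def)
  have "0 \<in> C" by (simp add: C_def quad_def)
  then have "subspace C"
    unfolding subspace_def using scale closed_cone_sum[OF closed scale add] by blast
  have "C = UNIV"
  proof (rule ccontr)
    assume "C \<noteq> UNIV"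
    then have "dim C < DIM(real^2)"
      using \<open>subspace C\<close> dim_eq_full[of C] dim_subset_UNIV[of C] span_eq_iff[of C] by force
    then obtain a where a: "a \<noteq> 0" "span C \<subseteq> {x. a \<bullet> x = 0}"
      using lowdim_subset_hyperplane by blast
    obtain x where "(N x)\<^sup>2 = quad p x" "a \<bullet> x \<noteq> 0"
      using minimal_trace_contact_off_line[OF major minimal a(1)] by blast
    then show False using a(2) span_base[of x C] by (auto simp: C_def)
  qed
  then have N: "(N x)\<^sup>2 = quad p x" for x by (auto simp: C_def)
  have "N x \<le> 1 \<longleftrightarrow> (N x)\<^sup>2 \<le> 1" for x
    using N_nonneg[of x] by (simp add: abs_square_le_1)
  then have "K = {x. quad p x \<le> 1}"
    using mem_iff_N N by auto
  moreover have "0 < quad p x" if "x \<noteq> 0" for x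
    using N_pos[OF that] N[of x] by (metis zero_less_power)
  ultimately show ?thesis using positive_quad_sublevel_ellipse by simp
qed

end

theorem theorem1p1:
  fixes K :: "(real^2) set"
  assumes "convex_body K" and "origin_symmetric K"
  shows "(\<forall>A B :: (real^2) set. compact A \<and> A \<noteq> {} \<and> compact B \<and> B \<noteq> {} \<longrightarrow>
            (hull_dist K (A + B))\<^sup>2 \<le> (hull_dist K A)\<^sup>2 + (hull_dist K B)\<^sup>2)
         \<longleftrightarrow> ellipse K"
proof
  interpret symmetric_body K using assms by unfold_locales
  show "ellipse K" if sub: "\<forall>A B :: (real^2) set. compact A \<and> A \<noteq> {} \<and> compact B \<and> B \<noteq> {} \<longrightarrow>
      (hull_dist K (A + B))\<^sup>2 \<le> (hull_dist K A)\<^sup>2 + (hull_dist K B)\<^sup>2"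
    by (rule min_diagonal_imp_ellipse) (rule subadditive_imp_min_diagonal[OF sub])
qed (use ellipse_hull_dist_subadditive assms(2) in blast)

end
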